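(* Let $n \geq 2$ be an integer, let $S$ be a ring and let $a,b \in S$ be two $n$-potent elements such that $\langle a,b\rangle_n$, $[a,b]_n^L$ and $[a,b]_n^R$ are units in $S$. Then the following hold: (1) For every integer $m > n$ such that $a^m = a$ and $b^m = b$, the anti-commutator $\langle a,b\rangle_m$ of degree $m$ is a unit in $S$ if and only if $\sum_{k=0}^{m-2}(a+b)^k$ is a unit in $S$. (2) For every integer $m > n$ such that $a^m = a$ and $b^m = b$, the commutators $[a,b]_m^L$ and $[a,b]_m^R$ of degree $m$ are both units in $S$ if and only if $\sum_{k=0}^{m-2}(a+b)^k$ is a unit in $S$.
   Context: Rings are associative with unity, not necessarily commutative. An element $x$ of a ring is $n$-potent if $x^n = x$. For elements $a,b$ of a ring $S$ and an integer $d \geq 2$: the anti-commutator of degree $d$ is $\langle a,b\rangle_d := (a+b)^d - a^d - b^d$; the left commutator of degree $d$ is $[a,b]_d^L := (a-b)(a+b)^{d-1} - (a^d - b^d)$; the right commutator of degree $d$ is $[a,b]_d^R := (a+b)^{d-1}(a-b) - (a^d-b^d)$. A unit is a two-sided invertible element. *)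

theory Defs
  imports "HOL-Algebra.Ring"
begin

definition n_potent :: "('a, 'b) ring_scheme \<Rightarrow> nat \<Rightarrow> 'a \<Rightarrow> bool" where
  "n_potent S n x \<longleftrightarrow> x \<in> carrier S \<and> x [^]\<^bsub>S\<^esub> n = x"

(* The three degree-d operations below are meant for d >= 2. *)

definition anti_commutator :: "('a, 'b) ring_scheme \<Rightarrow> nat \<Rightarrow> 'a \<Rightarrow> 'a \<Rightarrow> 'a" where
  "anti_commutator S d a b =
     (a \<oplus>\<^bsub>S\<^esub> b) [^]\<^bsub>S\<^esub> d \<ominus>\<^bsub>S\<^esub> a [^]\<^bsub>S\<^esub> d \<ominus>\<^bsub>S\<^esub> b [^]\<^bsub>S\<^esub> d"

definition left_commutator :: "('a, 'b) ring_scheme \<Rightarrow> nat \<Rightarrow> 'a \<Rightarrow> 'a \<Rightarrow> 'a" where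
  "left_commutator S d a b =
     ((a \<ominus>\<^bsub>S\<^esub> b) \<otimes>\<^bsub>S\<^esub> ((a \<oplus>\<^bsub>S\<^esub> b) [^]\<^bsub>S\<^esub> (d - 1)))
       \<ominus>\<^bsub>S\<^esub> (a [^]\<^bsub>S\<^esub> d \<ominus>\<^bsub>S\<^esub> b [^]\<^bsub>S\<^esub> d)"

definition right_commutator :: "('a, 'b) ring_scheme \<Rightarrow> nat \<Rightarrow> 'a \<Rightarrow> 'a \<Rightarrow> 'a" where
  "right_commutator S d a b =
     (((a \<oplus>\<^bsub>S\<^esub> b) [^]\<^bsub>S\<^esub> (d - 1)) \<otimes>\<^bsub>S\<^esub> (a \<ominus>\<^bsub>S\<^esub> b))
       \<ominus>\<^bsub>S\<^esub> (a [^]\<^bsub>S\<^esub> d \<ominus>\<^bsub>S\<^esub> b [^]\<^bsub>S\<^esub> d)"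

end

theory Submission imports Defs "HOL-Algebra.Divisibility" begin

text \<open>
  Put \<open>s = a + b\<close>, \<open>t = a - b\<close> and \<open>P d = s ^ (d - 1) - 1\<close>. Whenever \<open>a ^ d = a\<close> and \<open>b ^ d = b\<close>,
  the three expressions of degree \<open>d\<close> factor as
  \<open>anti = s * P d\<close>, \<open>left = t * P d\<close> and \<open>right = P d * t\<close>, and the geometric series gives
  \<open>P d = (s - 1) * (1 + s + \<dots> + s ^ (d - 2))\<close>.
  Powers of \<open>s\<close> commute with each other, and a factor of a unit that commutes with its cofactor is
  itself a unit. Hence in degree \<open>n\<close> the unit \<open>s * P n\<close> makes \<open>s\<close>, \<open>P n\<close> and \<open>s - 1\<close> units, and then
  the unit \<open>t * P n\<close> makes \<open>t\<close> a unit. In degree \<open>m\<close> each of the three expressions is therefore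
  the sum \<open>1 + s + \<dots> + s ^ (m - 2)\<close> multiplied by units, so it is a unit exactly when this sum is.
\<close>

lemma (in monoid) unit_mult_left_iff:
  assumes "u \<in> Units G" "x \<in> carrier G"
  shows "u \<otimes> x \<in> Units G \<longleftrightarrow> x \<in> Units G"
  using assms by (meson Units_closed Units_m_closed prod_unit_l)

lemma (in monoid) unit_mult_right_iff:
  assumes "u \<in> Units G" "x \<in> carrier G"
  shows "x \<otimes> u \<in> Units G \<longleftrightarrow> x \<in> Units G"
  using assms by (meson Units_closed Units_m_closed prod_unit_r)

text \<open>
  Invertibility of \<open>x \<otimes> y\<close> alone gives \<open>x\<close> only a right inverse; commutation turns
  the same equation into a left inverse as well.
\<close>
lemma (in monoid) Units_if_commuting_mult_Units:
  assumes x: "x \<in> carrier G" and y: "y \<in> carrier G"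
    and comm: "x \<otimes> y = y \<otimes> x" and u: "x \<otimes> y \<in> Units G"
  shows "x \<in> Units G" and "y \<in> Units G"
proof -
  let ?v = "inv (x \<otimes> y)"
  have v: "?v \<in> carrier G" using u by simp
  have right: "x \<otimes> (y \<otimes> ?v) = \<one>"
    using x y v u by (metis Units_r_inv m_assoc)
  have left: "(?v \<otimes> y) \<otimes> x = \<one>"
    using x y v u comm by (metis Units_l_inv m_assoc)
  have "?v \<otimes> y = y \<otimes> ?v"
    using inv_unique[OF left right] x y v by simp
  then show "x \<in> Units G"
    using left right x y v unfolding Units_def by (auto intro!: bexI[of _ "y \<otimes> ?v"])
  then show "y \<in> Units G"
    using u y unit_mult_left_iff by blast
qed

lemma (in ring) geometric_sum_left:
  assumes s: "s \<in> carrier R"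
  shows "(s \<ominus> \<one>) \<otimes> (\<Oplus>k\<in>{..j}. s [^] (k::nat)) = s [^] Suc j \<ominus> \<one>"
proof (induction j)
  case 0
  then show ?case using s by (simp add: minus_eq)
next
  case (Suc j)
  let ?G = "\<Oplus>k\<in>{..j}. s [^] (k::nat)"
  have G: "?G \<in> carrier R" using s by (simp add: finsum_closed Pi_def)
  define p where "p = s [^] Suc j"
  have p: "p \<in> carrier R" unfolding p_def using s by simp
  have sp: "s \<otimes> p = s [^] Suc (Suc j)"
    unfolding p_def using s by (metis nat_pow_Suc2)
  have "(s \<ominus> \<one>) \<otimes> (\<Oplus>k\<in>{..Suc j}. s [^] (k::nat)) = (s \<ominus> \<one>) \<otimes> (p \<oplus> ?G)"
    unfolding p_def using s by (simp add: Pi_def)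
  also have "\<dots> = (s \<ominus> \<one>) \<otimes> p \<oplus> (p \<ominus> \<one>)"
    using Suc s G p by (simp add: r_distr p_def)
  also have "\<dots> = s \<otimes> p \<ominus> \<one>"
    using s p by algebra
  finally show ?case by (simp only: sp)
qed

lemma (in ring) pow_pred_minus_one_factor:
  assumes s: "s \<in> carrier R" and m: "m \<ge> 2"
  shows "s [^] (m - 1) \<ominus> \<one> = (s \<ominus> \<one>) \<otimes> (\<Oplus>k\<in>{0..m - 2}. s [^] (k::nat))"
proof -
  have "Suc (m - 2) = m - 1" using m by simp
  then show ?thesis
    using geometric_sum_left[OF s, of "m - 2"] by (simp add: atLeast0AtMost)
qed

text \<open>
  The powers of \<open>s\<close> commute with \<open>s\<close>, so the two factors of \<open>s [^] (d - 1) \<ominus> \<one>\<close> commute.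
  This is what lets invertibility of that product pass to \<open>s \<ominus> \<one>\<close>.
\<close>
lemma (in ring) geometric_sum_commute:
  assumes s: "s \<in> carrier R"
  shows "(s \<ominus> \<one>) \<otimes> (\<Oplus>k\<in>{0..j}. s [^] (k::nat)) = (\<Oplus>k\<in>{0..j}. s [^] k) \<otimes> (s \<ominus> \<one>)"
proof -
  let ?G = "\<Oplus>k\<in>{0..j}. s [^] (k::nat)"
  have G: "?G \<in> carrier R" using s by (simp add: finsum_closed Pi_def)
  have "s \<otimes> ?G = (\<Oplus>k\<in>{0..j}. s \<otimes> s [^] k)"
    using s by (simp add: finsum_rdistr Pi_def)
  also have "\<dots> = (\<Oplus>k\<in>{0..j}. s [^] k \<otimes> s)"
    using s by (metis nat_pow_Suc nat_pow_Suc2)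
  also have "\<dots> = ?G \<otimes> s"
    using s by (simp add: finsum_ldistr Pi_def)
  finally have "s \<otimes> ?G = ?G \<otimes> s" .
  then show ?thesis
    using s G by (simp add: minus_eq r_distr l_distr r_minus l_minus)
qed

lemma (in ring) pow_minus_one_commute:
  assumes s: "s \<in> carrier R"
  shows "s \<otimes> (s [^] (i::nat) \<ominus> \<one>) = (s [^] i \<ominus> \<one>) \<otimes> s"
proof -
  have "s \<otimes> s [^] i = s [^] i \<otimes> s"
    using s by (metis nat_pow_Suc nat_pow_Suc2)
  then show ?thesis
    using s by (simp add: minus_eq r_distr l_distr r_minus l_minus)
qed

text \<open>
  Potency replaces \<open>a ^ m + b ^ m\<close> by \<open>a + b\<close> here, and \<open>a ^ m - b ^ m\<close> by \<open>a - b\<close> in the two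
  commutators, so the subtracted term is a multiple of the same element as the leading one.
\<close>
lemma (in ring) anti_commutator_factor:
  assumes ab: "a \<in> carrier R" "b \<in> carrier R" and m: "m \<ge> 2"
    and pot: "a [^] m = a" "b [^] m = b"
  shows "anti_commutator R m a b = (a \<oplus> b) \<otimes> ((a \<oplus> b) [^] (m - 1) \<ominus> \<one>)"
proof -
  define p where "p = (a \<oplus> b) [^] (m - 1)"
  have p: "p \<in> carrier R" unfolding p_def using ab by simp
  have "(a \<oplus> b) [^] m = (a \<oplus> b) \<otimes> p"
    using m ab nat_pow_Suc2[of "a \<oplus> b" "m - 1"] unfolding p_def by simp
  then have "anti_commutator R m a b = (a \<oplus> b) \<otimes> p \<ominus> a \<ominus> b"
    unfolding anti_commutator_def by (simp only: pot)
  also have "\<dots> = (a \<oplus> b) \<otimes> (p \<ominus> \<one>)"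
    using ab p by (simp add: minus_eq r_distr l_distr r_minus minus_add a_ac)
  finally show ?thesis unfolding p_def .
qed

lemma (in ring) left_commutator_factor:
  assumes ab: "a \<in> carrier R" "b \<in> carrier R"
    and pot: "a [^] m = a" "b [^] m = b"
  shows "left_commutator R m a b = (a \<ominus> b) \<otimes> ((a \<oplus> b) [^] (m - 1) \<ominus> \<one>)"
  unfolding left_commutator_def pot
  using ab by (simp add: minus_eq r_distr r_minus)

lemma (in ring) right_commutator_factor:
  assumes ab: "a \<in> carrier R" "b \<in> carrier R"
    and pot: "a [^] m = a" "b [^] m = b"
  shows "right_commutator R m a b = ((a \<oplus> b) [^] (m - 1) \<ominus> \<one>) \<otimes> (a \<ominus> b)"
  unfolding right_commutator_def pot
  using ab by (simp add: minus_eq l_distr l_minus)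

theorem theoremB:
  fixes S :: "('a, 'b) ring_scheme" and a b :: 'a and n :: nat
  assumes "n \<ge> 2"
    and "ring S"
    and "n_potent S n a" and "n_potent S n b"
    and "anti_commutator S n a b \<in> Units S"
    and "left_commutator S n a b \<in> Units S"
    and "right_commutator S n a b \<in> Units S"
  shows "(\<forall>m::nat. m > n \<and> a [^]\<^bsub>S\<^esub> m = a \<and> b [^]\<^bsub>S\<^esub> m = b \<longrightarrow>
            (anti_commutator S m a b \<in> Units S
               \<longleftrightarrow> (\<Oplus>\<^bsub>S\<^esub>k\<in>{0..m - 2}. (a \<oplus>\<^bsub>S\<^esub> b) [^]\<^bsub>S\<^esub> k) \<in> Units S))
       \<and> (\<forall>m::nat. m > n \<and> a [^]\<^bsub>S\<^esub> m = a \<and> b [^]\<^bsub>S\<^esub> m = b \<longrightarrow>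
            (left_commutator S m a b \<in> Units S \<and> right_commutator S m a b \<in> Units S
               \<longleftrightarrow> (\<Oplus>\<^bsub>S\<^esub>k\<in>{0..m - 2}. (a \<oplus>\<^bsub>S\<^esub> b) [^]\<^bsub>S\<^esub> k) \<in> Units S))"
proof -
  interpret ring S by fact
  have ab: "a \<in> carrier S" "b \<in> carrier S"
    and pot: "a [^]\<^bsub>S\<^esub> n = a" "b [^]\<^bsub>S\<^esub> n = b"
    using assms(3,4) unfolding n_potent_def by auto
  define s where "s = a \<oplus>\<^bsub>S\<^esub> b"
  define t where "t = a \<ominus>\<^bsub>S\<^esub> b"
  define P where "P d = s [^]\<^bsub>S\<^esub> (d - 1) \<ominus>\<^bsub>S\<^esub> \<one>\<^bsub>S\<^esub>" for d :: nat
  define G where "G d = (\<Oplus>\<^bsub>S\<^esub>k\<in>{0..d - 2}. s [^]\<^bsub>S\<^esub> k)" for d :: nat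
  have s: "s \<in> carrier S" and t: "t \<in> carrier S" using ab unfolding s_def t_def by auto
  have P: "P d \<in> carrier S" for d unfolding P_def using s by simp
  have G: "G d \<in> carrier S" for d unfolding G_def using s by (simp add: finsum_closed Pi_def)

  have "s \<otimes>\<^bsub>S\<^esub> P n \<in> Units S"
    using assms(5) anti_commutator_factor[OF ab assms(1) pot] unfolding s_def P_def by simp
  then have s_unit: "s \<in> Units S" and Pn_unit: "P n \<in> Units S"
    using Units_if_commuting_mult_Units[OF s P] pow_minus_one_commute[OF s]
    unfolding P_def by blast+
  have "t \<otimes>\<^bsub>S\<^esub> P n \<in> Units S"
    using assms(6) left_commutator_factor[OF ab pot] unfolding s_def t_def P_def by simp
  then have t_unit: "t \<in> Units S"
    using unit_mult_right_iff[OF Pn_unit t] by simp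
  have s1: "s \<ominus>\<^bsub>S\<^esub> \<one>\<^bsub>S\<^esub> \<in> carrier S" using s by simp
  have s1_unit: "s \<ominus>\<^bsub>S\<^esub> \<one>\<^bsub>S\<^esub> \<in> Units S"
    using Units_if_commuting_mult_Units(1)[OF s1 G[of n]] geometric_sum_commute[OF s]
      pow_pred_minus_one_factor[OF s assms(1)] Pn_unit
    unfolding P_def G_def by simp

  have P_iff: "P m \<in> Units S \<longleftrightarrow> G m \<in> Units S" if "m > n" for m
    using pow_pred_minus_one_factor[OF s, of m] that assms(1) unit_mult_left_iff[OF s1_unit G]
    unfolding P_def G_def by simp
  have "anti_commutator S m a b \<in> Units S \<longleftrightarrow> G m \<in> Units S"
    and "left_commutator S m a b \<in> Units S \<and> right_commutator S m a b \<in> Units S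
           \<longleftrightarrow> G m \<in> Units S"
    if m: "m > n" and potm: "a [^]\<^bsub>S\<^esub> m = a" "b [^]\<^bsub>S\<^esub> m = b" for m
  proof -
    have m2: "m \<ge> 2" using m assms(1) by simp
    show "anti_commutator S m a b \<in> Units S \<longleftrightarrow> G m \<in> Units S"
      using anti_commutator_factor[OF ab m2 potm] unit_mult_left_iff[OF s_unit P] P_iff[OF m]
      unfolding s_def P_def by simp
    show "left_commutator S m a b \<in> Units S \<and> right_commutator S m a b \<in> Units S
           \<longleftrightarrow> G m \<in> Units S"
      using left_commutator_factor[OF ab potm] right_commutator_factor[OF ab potm]
        unit_mult_left_iff[OF t_unit P] unit_mult_right_iff[OF t_unit P] P_iff[OF m]
      unfolding s_def t_def P_def by simp
  qed
  then show ?thesis unfolding G_def s_def by blast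
qed

end
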